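(* Let $X$ and $Y$ be separable metrizable spaces and let $f : X \to Y$ be a continuous surjection that is closed--constructible, i.e. for every closed set $F \subseteq X$ the image $f(F)$ is a constructible subset of $Y$. Then $f$ is piece-wise closed: there exist closed sets $Z_1, Z_2, \ldots \subseteq X$ with $X = \bigcup_{n} Z_n$ such that for every $n$ the restriction $f|_{Z_n}$ is a closed map.
   Context: A subset $B \subseteq Y$ is constructible if it belongs to the smallest family of subsets of $Y$ that contains all open sets and is stable under finite intersections and complements (equivalently, $B$ is a finite union of locally closed sets, a locally closed set being the intersection of an open set and a closed set). A function $f: X \to Y$ is closed--constructible if it takes closed subsets of $X$ to constructible subsets of $Y$. A function $f : X \to Y$ is piece-wise closed if $X$ can be written as a countable union of closed sets $Z_n$ such that $f$ is closed on every $Z_n$ (i.e. $f|_{Z_n}$ maps closed subsets of $Z_n$ to closed subsets of $Y$). *)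

theory Defs
  imports "HOL-Analysis.Analysis"
begin

inductive constructible_in :: "'a topology \<Rightarrow> 'a set \<Rightarrow> bool" for Y where
  open_constructible: "openin Y U \<Longrightarrow> constructible_in Y U"
| inter_constructible: "constructible_in Y A \<Longrightarrow> constructible_in Y B \<Longrightarrow> constructible_in Y (A \<inter> B)"
| compl_constructible: "constructible_in Y A \<Longrightarrow> constructible_in Y (topspace Y - A)"

definition closed_constructible :: "'a topology \<Rightarrow> 'b topology \<Rightarrow> ('a \<Rightarrow> 'b) \<Rightarrow> bool" where
  "closed_constructible X Y f \<longleftrightarrow> (\<forall>F. closedin X F \<longrightarrow> constructible_in Y (f ` F))"

definition piecewise_closed :: "'a topology \<Rightarrow> 'b topology \<Rightarrow> ('a \<Rightarrow> 'b) \<Rightarrow> bool" where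
  "piecewise_closed X Y f \<longleftrightarrow>
     (\<exists>Z :: nat \<Rightarrow> 'a set. (\<forall>n. closedin X (Z n)) \<and> (\<Union>n. Z n) = topspace X \<and>
        (\<forall>n. closed_map (subtopology X (Z n)) Y f))"

end

theory Submission
  imports Defs
begin

text \<open>
  By the Lindelof property there is a largest open set on which \<open>f\<close> is piece-wise closed. Replacing
  \<open>X\<close> by its complement, suppose that \<open>X\<close> is nonempty and that \<open>f\<close> is piece-wise closed on no
  nonempty open set; we construct a closed set with a non-constructible image.

  For \<open>A \<subseteq> Y\<close> put \<open>R\<^sub>0 = A\<close> and \<open>R\<^sub>n\<^sub>+\<^sub>1 = A \<inter> cl (cl R\<^sub>n - A)\<close>. If \<open>A\<close> is a Boolean combination of \<open>k\<close>
  open sets, then each step from a point of \<open>A\<close> to a nearby point outside \<open>A\<close> strictly enlarges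
  the collection of those open sets containing the point, so \<open>R\<^sub>n\<close> is empty for \<open>n > k\<close>.

  On the other hand, every nonempty open \<open>U\<close> contains a closed \<open>F\<close> such that \<open>f F\<close> has a nonempty
  \<open>R\<^sub>n\<close>. To pass from \<open>n\<close> to \<open>n + 1\<close>, note that \<open>f\<close> fails to be closed inside every nonempty open
  set, which gives a point \<open>y\<close> of the image and open sets \<open>W\<^sub>i\<close> forming a locally finite family
  whose images converge to \<open>y\<close>; sets \<open>F\<^sub>i \<subseteq> W\<^sub>i\<close> for \<open>n\<close> put \<open>y\<close> into \<open>cl R\<^sub>n\<close>. Doing this in a
  sequence of open sets shrinking to a point \<open>x\<close> puts \<open>f x\<close> into \<open>R\<^sub>n\<^sub>+\<^sub>1\<close>. The pieces do not interfere,
  since all the sets in \<open>Y\<close> involved are countable and closed and the preimage of such a set has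
  empty interior. Gluing pieces for all \<open>n\<close> along one more locally finite family gives the
  required closed set.
\<close>

section \<open>Countability axioms\<close>

lemma (in Metric_space) separable_imp_second_countable_mtopology:
  assumes "separable_space mtopology"
  shows "second_countable mtopology"
proof -
  obtain C where C: "countable C" "C \<subseteq> M" "mtopology closure_of C = M"
    using assms by (auto simp: separable_space_def)
  let ?B = "(\<lambda>(c, n::nat). mball c (1 / Suc n)) ` (C \<times> UNIV)"
  have "\<exists>V\<in>?B. x \<in> V \<and> V \<subseteq> U" if U: "openin mtopology U" "x \<in> U" for U x
  proof -
    have x: "x \<in> M" using openin_subset[OF U(1)] U(2) by auto
    obtain r where r: "r > 0" "mball x r \<subseteq> U"
      using U by (auto simp: openin_mtopology)
    obtain n :: nat where n: "1 / Suc n < r / 2"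
      using r(1) nat_approx_posE[of "r / 2"] by auto
    have "\<forall>e>0. \<exists>c\<in>C. c \<in> mball x e"
      using C(3) x unfolding metric_closure_of by blast
    moreover have "0 < 1 / real (Suc n)" by simp
    ultimately obtain c where c: "c \<in> C" "c \<in> mball x (1 / Suc n)" by blast
    have "mball c (1 / Suc n) \<subseteq> mball x r"
      using c n by (intro mball_subset) (auto simp: commute)
    moreover have "x \<in> mball c (1 / Suc n)"
      using c by (simp add: commute)
    ultimately show ?thesis using c(1) r(2) by blast
  qed
  moreover have "countable ?B" using C(1) by auto
  moreover have "\<forall>V\<in>?B. openin mtopology V" by auto
  ultimately show ?thesis unfolding second_countable_def by blast
qed

lemma metrizable_separable_imp_second_countable:
  assumes "metrizable_space X" "separable_space X"
  shows "second_countable X"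
  using assms Metric_space.separable_imp_second_countable_mtopology
  unfolding metrizable_space_def by blast

lemma second_countable_countable_subfamily:
  assumes "second_countable X" "\<And>U. U \<in> \<U> \<Longrightarrow> openin X U"
  obtains \<V> where "countable \<V>" "\<V> \<subseteq> \<U>" "\<Union>\<V> = \<Union>\<U>"
proof -
  let ?S = "subtopology X (\<Union>\<U>)"
  have union: "openin X (\<Union>\<U>)" using assms(2) by (rule openin_Union)
  have "topspace ?S = \<Union>\<U>"
    using openin_subset[OF union] by (simp add: inf.absorb2)
  moreover have "openin ?S U" if "U \<in> \<U>" for U
    using that union assms(2) by (auto simp: openin_open_subtopology)
  moreover have "Lindelof_space ?S"
    using assms(1) by (intro second_countable_imp_Lindelof_space second_countable_subtopology)
  ultimately obtain \<V> where "countable \<V>" "\<V> \<subseteq> \<U>" "\<Union>\<V> = \<Union>\<U>"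
    using Lindelof_spaceD[of ?S \<U>] by metis
  then show ?thesis by (rule that)
qed

section \<open>Families shrinking to a point\<close>

definition shrinks_to :: "'a topology \<Rightarrow> ('i \<Rightarrow> 'a set) \<Rightarrow> 'a \<Rightarrow> bool" where
  "shrinks_to X S x \<longleftrightarrow>
    x \<in> topspace X \<and> (\<forall>U. openin X U \<and> x \<in> U \<longrightarrow> (\<forall>\<^sub>\<infinity>i. S i \<subseteq> U))"

lemma shrinks_toD:
  "shrinks_to X S x \<Longrightarrow> openin X U \<Longrightarrow> x \<in> U \<Longrightarrow> \<forall>\<^sub>\<infinity>i. S i \<subseteq> U"
  by (simp add: shrinks_to_def)

lemma shrinks_to_imp_in_topspace: "shrinks_to X S x \<Longrightarrow> x \<in> topspace X"
  by (simp add: shrinks_to_def)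

lemma shrinks_to_obtain_subset:
  fixes S :: "nat \<Rightarrow> 'a set"
  assumes "shrinks_to X S x" "openin X U" "x \<in> U"
  obtains i where "S i \<subseteq> U"
  using eventually_happens[OF shrinks_toD[OF assms]] by (auto simp: cofinite_eq_sequentially)

lemma shrinks_to_mono:
  assumes "shrinks_to X S x" "\<And>i. T i \<subseteq> S i"
  shows "shrinks_to X T x"
  unfolding shrinks_to_def
proof (intro conjI allI impI)
  show "x \<in> topspace X" by (rule shrinks_to_imp_in_topspace[OF assms(1)])
  fix U assume "openin X U \<and> x \<in> U"
  then have "\<forall>\<^sub>\<infinity>i. S i \<subseteq> U" using shrinks_toD[OF assms(1)] by blast
  then show "\<forall>\<^sub>\<infinity>i. T i \<subseteq> U"
    by (rule eventually_mono) (use assms(2) in blast)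
qed

lemma shrinks_to_continuous_map_image:
  assumes "shrinks_to X S x" "continuous_map X Y f"
  shows "shrinks_to Y (\<lambda>i. f ` S i) (f x)"
  unfolding shrinks_to_def
proof (intro conjI allI impI)
  have x: "x \<in> topspace X" by (rule shrinks_to_imp_in_topspace[OF assms(1)])
  then show "f x \<in> topspace Y"
    using assms(2) by (auto simp: continuous_map_def)
  fix U assume U: "openin Y U \<and> f x \<in> U"
  have "\<forall>\<^sub>\<infinity>i. S i \<subseteq> {z \<in> topspace X. f z \<in> U}"
    using U x by (intro shrinks_toD[OF assms(1)] openin_continuous_map_preimage[OF assms(2)]) auto
  then show "\<forall>\<^sub>\<infinity>i. f ` S i \<subseteq> U"
    by (rule eventually_mono) auto
qed

lemma first_countable_shrinking_base:
  assumes "first_countable X" "x \<in> topspace X"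
  obtains B :: "nat \<Rightarrow> 'a set" where "\<And>n. openin X (B n)" "\<And>n. x \<in> B n" "shrinks_to X B x"
proof -
  obtain \<B> where \<B>: "countable \<B>" "\<And>V. V \<in> \<B> \<Longrightarrow> openin X V"
      "\<And>U. openin X U \<Longrightarrow> x \<in> U \<Longrightarrow> \<exists>V\<in>\<B>. x \<in> V \<and> V \<subseteq> U"
    using assms unfolding first_countable_def by metis
  define \<C> where "\<C> = {V \<in> \<B>. x \<in> V}"
  have "\<C> \<noteq> {}" "countable \<C>"
    using \<B>(1) \<B>(3)[OF openin_topspace assms(2)] by (auto simp: \<C>_def)
  then obtain V :: "nat \<Rightarrow> 'a set" where V: "range V = \<C>"
    by (metis range_from_nat_into)
  show ?thesis
  proof
    fix n
    show "openin X (\<Inter>i\<le>n. V i)"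
      using V \<B>(2) by (intro openin_INT2) (auto simp: \<C>_def)
    show "x \<in> (\<Inter>i\<le>n. V i)"
      using V by (auto simp: \<C>_def)
  next
    have "\<forall>\<^sub>F n in sequentially. (\<Inter>i\<le>n. V i) \<subseteq> U" if U: "openin X U" "x \<in> U" for U
    proof -
      obtain m where "V m \<subseteq> U"
        using \<B>(3)[OF U] U(2) V unfolding \<C>_def by (metis (mono_tags, lifting) mem_Collect_eq rangeE)
      then have "(\<Inter>i\<le>n. V i) \<subseteq> U" if "n \<ge> m" for n
        using that by blast
      then show ?thesis by (rule eventually_sequentiallyI)
    qed
    then show "shrinks_to X (\<lambda>n. \<Inter>i\<le>n. V i) x"
      using assms(2) by (simp add: shrinks_to_def cofinite_eq_sequentially)
  qed
qed

lemma shrinks_to_eventually_disjnt: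
  assumes "Hausdorff_space X" "shrinks_to X S x" "p \<in> topspace X" "p \<noteq> x"
  obtains N where "openin X N" "p \<in> N" "\<forall>\<^sub>\<infinity>i. disjnt N (S i)"
proof -
  obtain N M where NM: "openin X N" "openin X M" "p \<in> N" "x \<in> M" "disjnt N M"
    using assms shrinks_to_imp_in_topspace unfolding Hausdorff_space_def by metis
  have "\<forall>\<^sub>\<infinity>i. disjnt N (S i)"
    using shrinks_toD[OF assms(2) NM(2,4)]
    by (rule eventually_mono) (use NM(5) disjnt_subset2 in blast)
  with NM that show ?thesis by blast
qed

lemma closedin_insert_UN_shrinks_to:
  assumes X: "Hausdorff_space X" and E: "\<And>i. closedin X (E i)" and shrinks: "shrinks_to X E x"
  shows "closedin X (insert x (\<Union>i. E i))"
  unfolding closedin_def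
proof (intro conjI)
  note x = shrinks_to_imp_in_topspace[OF shrinks]
  show "insert x (\<Union>i. E i) \<subseteq> topspace X"
    using x E closedin_subset by fastforce
  show "openin X (topspace X - insert x (\<Union>i. E i))"
  proof (subst openin_subopen, intro ballI)
    fix p assume p: "p \<in> topspace X - insert x (\<Union>i. E i)"
    then obtain N where N: "openin X N" "p \<in> N" "\<forall>\<^sub>\<infinity>i. disjnt N (E i)"
      using shrinks_to_eventually_disjnt[OF X shrinks, of p] by blast
    define C where "C = {x} \<union> (\<Union>i\<in>{i. \<not> disjnt N (E i)}. E i)"
    have "closedin X C"
      unfolding C_def using x E N(3) X
      by (intro closedin_Un closedin_Union) (auto simp: eventually_cofinite closedin_Hausdorff_singleton)
    then have "openin X (N - C)" by (rule openin_diff[OF N(1)])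
    moreover have "p \<in> N - C" using p N(2) by (auto simp: C_def)
    moreover have "N - C \<subseteq> topspace X - insert x (\<Union>i. E i)"
      using openin_subset[OF N(1)] by (auto simp: C_def disjnt_iff)
    ultimately show "\<exists>U. openin X U \<and> p \<in> U \<and> U \<subseteq> topspace X - insert x (\<Union>i. E i)"
      by blast
  qed
qed

section \<open>Locally finite indexed families\<close>

definition locally_finite_family :: "'a topology \<Rightarrow> ('i \<Rightarrow> 'a set) \<Rightarrow> bool" where
  "locally_finite_family X W \<longleftrightarrow>
    (\<forall>x\<in>topspace X. \<exists>N. openin X N \<and> x \<in> N \<and> (\<forall>\<^sub>\<infinity>i. disjnt N (W i)))"

lemma closedin_UN_locally_finite_family:
  assumes "locally_finite_family X W" and F: "\<And>i. closedin X (F i)" "\<And>i. F i \<subseteq> W i"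
  shows "closedin X (\<Union>i. F i)"
proof (rule closedin_locally_finite_Union)
  have "\<exists>N. openin X N \<and> x \<in> N \<and> finite {S \<in> range F. S \<inter> N \<noteq> {}}"
    if x: "x \<in> topspace X" for x
  proof -
    obtain N where N: "openin X N" "x \<in> N" "finite {i. \<not> disjnt N (W i)}"
      using assms(1) x unfolding locally_finite_family_def eventually_cofinite by blast
    have "{S \<in> range F. S \<inter> N \<noteq> {}} \<subseteq> F ` {i. \<not> disjnt N (W i)}"
      using F(2) by (auto simp: disjnt_iff)
    then have "finite {S \<in> range F. S \<inter> N \<noteq> {}}"
      by (rule finite_subset) (use N(3) in simp)
    with N show ?thesis by blast
  qed
  moreover have "\<Union>(range F) \<subseteq> topspace X"
    using F(1) closedin_subset by blast
  ultimately show "locally_finite_in X (range F)"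
    by (simp add: locally_finite_in_def)
qed (use F in auto)

lemma locally_finite_family_shrinking_images:
  assumes "Hausdorff_space Y" "continuous_map X Y f" "shrinks_to Y (\<lambda>i. f ` W i) y"
    and N: "openin X N" "{x \<in> topspace X. f x = y} \<subseteq> N" "\<And>i. disjnt N (W i)"
  shows "locally_finite_family X W"
  unfolding locally_finite_family_def
proof
  fix x assume x: "x \<in> topspace X"
  show "\<exists>N. openin X N \<and> x \<in> N \<and> (\<forall>\<^sub>\<infinity>i. disjnt N (W i))"
  proof (cases "f x = y")
    case True
    then show ?thesis using N x by (intro exI[of _ N]) auto
  next
    case False
    moreover have "f x \<in> topspace Y" using assms(2) x by (auto simp: continuous_map_def)
    ultimately obtain M where M: "openin Y M" "f x \<in> M" "\<forall>\<^sub>\<infinity>i. disjnt M (f ` W i)"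
      using shrinks_to_eventually_disjnt[OF assms(1,3)] by blast
    let ?M = "{z \<in> topspace X. f z \<in> M}"
    have "\<forall>\<^sub>\<infinity>i. disjnt ?M (W i)"
      using M(3) by (rule eventually_mono) (auto simp: disjnt_iff)
    then show ?thesis
      using openin_continuous_map_preimage[OF assms(2) M(1)] x M(2) by (intro exI[of _ ?M]) auto
  qed
qed

lemma closedin_continuous_map_fibre:
  assumes "continuous_map X Y f" "t1_space Y"
  shows "closedin X {x \<in> topspace X. f x = y}"
proof (cases "y \<in> topspace Y")
  case True
  then have "closedin Y {y}" by (rule closedin_t1_singleton[OF assms(2)])
  from closedin_continuous_map_preimage[OF assms(1) this] show ?thesis by simp
next
  case False
  then have "{x \<in> topspace X. f x = y} = {}"
    using assms(1) by (auto simp: continuous_map_def)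
  then show ?thesis by (simp only: closedin_empty)
qed

text \<open>
  The \<open>W i\<close> stay away from the fibre over \<open>y\<close> by normality, and locally from every other point
  because their images shrink to \<open>y\<close>.
\<close>

lemma closure_of_image_obtain_locally_finite_family:
  assumes "normal_space X" "Hausdorff_space Y" "first_countable Y" "continuous_map X Y f"
    and V: "openin X V" and H: "closedin X H" "H \<subseteq> V" and y: "y \<in> Y closure_of (f ` H)" "y \<notin> f ` H"
  obtains W :: "nat \<Rightarrow> 'a set" where "\<And>i. openin X (W i)" "\<And>i. W i \<noteq> {}" "\<And>i. W i \<subseteq> V"
    "shrinks_to Y (\<lambda>i. f ` W i) y" "locally_finite_family X W"
proof -
  let ?P = "{x \<in> topspace X. f x = y}"
  have "closedin X ?P"
    by (rule closedin_continuous_map_fibre[OF assms(4) Hausdorff_imp_t1_space[OF assms(2)]])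
  moreover have "disjnt ?P H" using y(2) by (auto simp: disjnt_iff)
  ultimately obtain N N' where N: "openin X N" "openin X N'" "?P \<subseteq> N" "H \<subseteq> N'" "disjnt N N'"
    using assms(1)[unfolded normal_space_def, rule_format, of ?P H] H(1) by blast
  have "y \<in> topspace Y" using y(1) by (simp add: in_closure_of)
  then obtain B :: "nat \<Rightarrow> 'b set" where B: "\<And>n. openin Y (B n)" "\<And>n. y \<in> B n" "shrinks_to Y B y"
    using first_countable_shrinking_base[OF assms(3)] by blast
  define W where "W i = N' \<inter> V \<inter> {x \<in> topspace X. f x \<in> B i}" for i
  show ?thesis
  proof
    show "openin X (W i)" for i
      unfolding W_def using N(2) V openin_continuous_map_preimage[OF assms(4) B(1)]
      by (intro openin_Int)
    show "W i \<noteq> {}" for i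
    proof -
      obtain h where "h \<in> H" "f h \<in> B i"
        using y(1) B(1,2)[of i] by (auto simp: in_closure_of)
      then have "h \<in> W i" using H(2) N(4) closedin_subset[OF H(1)] by (auto simp: W_def)
      then show ?thesis by blast
    qed
    show "W i \<subseteq> V" for i by (auto simp: W_def)
    show shrinks: "shrinks_to Y (\<lambda>i. f ` W i) y"
      by (rule shrinks_to_mono[OF B(3)]) (auto simp: W_def)
    have "disjnt N (W i)" for i
      using N(5) by (auto simp: W_def disjnt_iff)
    then show "locally_finite_family X W"
      by (rule locally_finite_family_shrinking_images[OF assms(2,4) shrinks N(1,3)])
  qed
qed

section \<open>Constructible sets\<close>

lemma constructible_in_imp_fsigma_in:
  assumes "metrizable_space Y" "constructible_in Y A"
  shows "fsigma_in Y A"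
proof -
  have "fsigma_in Y A \<and> gdelta_in Y A"
    using assms(2)
  proof (induction rule: constructible_in.induct)
    case (open_constructible U)
    then show ?case using assms(1) open_imp_fsigma_in open_imp_gdelta_in by blast
  next
    case (inter_constructible A B)
    then show ?case by (simp add: fsigma_in_Int gdelta_in_Int)
  next
    case (compl_constructible A)
    then show ?case by (simp add: fsigma_in_diff gdelta_in_diff)
  qed
  then show ?thesis ..
qed

definition sets_containing :: "'b set set \<Rightarrow> 'b \<Rightarrow> 'b set set" where
  "sets_containing \<U> p = {U \<in> \<U>. p \<in> U}"

definition determined_by :: "'b topology \<Rightarrow> 'b set set \<Rightarrow> 'b set \<Rightarrow> bool" where
  "determined_by Y \<U> A \<longleftrightarrow> (\<forall>p\<in>topspace Y. \<forall>q\<in>topspace Y.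
    sets_containing \<U> p = sets_containing \<U> q \<longrightarrow> (p \<in> A \<longleftrightarrow> q \<in> A))"

lemma determined_by_Int:
  assumes "determined_by Y \<U> A" "determined_by Y \<V> B"
  shows "determined_by Y (\<U> \<union> \<V>) (A \<inter> B)"
proof -
  have "sets_containing \<U> p = sets_containing \<U> q" "sets_containing \<V> p = sets_containing \<V> q"
    if "sets_containing (\<U> \<union> \<V>) p = sets_containing (\<U> \<union> \<V>) q" for p q
    using that unfolding sets_containing_def by blast+
  then show ?thesis
    using assms unfolding determined_by_def by (metis Int_iff)
qed

lemma determined_by_compl:
  "determined_by Y \<U> A \<Longrightarrow> determined_by Y \<U> (topspace Y - A)"
  unfolding determined_by_def by (metis Diff_iff)

lemma constructible_in_imp_determined_by:
  assumes "constructible_in Y A"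
  shows "\<exists>\<U>. finite \<U> \<and> \<U> \<subseteq> Collect (openin Y) \<and> determined_by Y \<U> A"
  using assms
proof (induction rule: constructible_in.induct)
  case (open_constructible U)
  then show ?case
    by (intro exI[of _ "{U}"]) (auto simp: determined_by_def sets_containing_def)
next
  case (inter_constructible A B)
  obtain \<U> where "finite \<U>" "\<U> \<subseteq> Collect (openin Y)" "determined_by Y \<U> A"
    using inter_constructible.IH(1) by blast
  moreover obtain \<V> where "finite \<V>" "\<V> \<subseteq> Collect (openin Y)" "determined_by Y \<V> B"
    using inter_constructible.IH(2) by blast
  ultimately show ?case
    by (intro exI[of _ "\<U> \<union> \<V>"]) (simp add: determined_by_Int)
next
  case (compl_constructible A)
  then show ?case using determined_by_compl by blast
qed

lemma closure_of_obtain_sets_containing_mono: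
  assumes "finite \<U>" "\<U> \<subseteq> Collect (openin Y)" "p \<in> Y closure_of S"
  obtains q where "q \<in> S" "sets_containing \<U> p \<subseteq> sets_containing \<U> q"
proof -
  have "openin Y (topspace Y \<inter> \<Inter>(sets_containing \<U> p))"
    using assms(1,2) by (intro openin_Int_Inter) (auto simp: sets_containing_def)
  moreover have "p \<in> topspace Y \<inter> \<Inter>(sets_containing \<U> p)"
    using assms(3) by (auto simp: sets_containing_def in_closure_of)
  ultimately obtain q where "q \<in> S" "q \<in> \<Inter>(sets_containing \<U> p)"
    using assms(3) unfolding in_closure_of by blast
  then show ?thesis
    by (intro that[of q]) (auto simp: sets_containing_def)
qed

section \<open>Alternation\<close>

primrec alternation :: "'b topology \<Rightarrow> 'b set \<Rightarrow> nat \<Rightarrow> 'b set" where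
  "alternation Y A 0 = A"
| "alternation Y A (Suc n) = A \<inter> Y closure_of (Y closure_of (alternation Y A n) - A)"

lemma card_sets_containing_alternation:
  assumes \<U>: "finite \<U>" "\<U> \<subseteq> Collect (openin Y)" "determined_by Y \<U> A"
    and "p \<in> alternation Y A n"
  shows "card (sets_containing \<U> p) + n \<le> card \<U>"
  using assms(4)
proof (induction n arbitrary: p)
  case 0
  then show ?case using \<U>(1) by (auto simp: sets_containing_def intro!: card_mono)
next
  case (Suc n)
  then have "p \<in> Y closure_of (Y closure_of (alternation Y A n) - A)" by simp
  then obtain q where q: "q \<in> Y closure_of (alternation Y A n)" "q \<notin> A"
      "sets_containing \<U> p \<subseteq> sets_containing \<U> q"
    using closure_of_obtain_sets_containing_mono[OF \<U>(1,2)] by blast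
  then obtain r where r: "r \<in> alternation Y A n" "sets_containing \<U> q \<subseteq> sets_containing \<U> r"
    using closure_of_obtain_sets_containing_mono[OF \<U>(1,2)] by blast
  have "p \<in> A" "p \<in> topspace Y" "q \<in> topspace Y"
    using Suc.prems q(1) by (auto simp: in_closure_of)
  then have "sets_containing \<U> p \<noteq> sets_containing \<U> q"
    using \<U>(3) q(2) unfolding determined_by_def by metis
  then have "card (sets_containing \<U> p) < card (sets_containing \<U> r)"
    using q(3) r(2) \<U>(1) by (intro psubset_card_mono) (auto simp: sets_containing_def)
  then show ?case using Suc.IH[OF r(1)] by simp
qed

lemma constructible_in_imp_alternation_empty:
  assumes "constructible_in Y A"
  obtains n where "alternation Y A n = {}"
proof -
  obtain \<U> where \<U>: "finite \<U>" "\<U> \<subseteq> Collect (openin Y)" "determined_by Y \<U> A"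
    using constructible_in_imp_determined_by[OF assms] by blast
  have "alternation Y A (Suc (card \<U>)) = {}"
    using card_sets_containing_alternation[OF \<U>, of _ "Suc (card \<U>)"] by fastforce
  then show ?thesis by (rule that)
qed

text \<open>
  The properties of a piece \<open>B\<close> of a larger set \<open>A\<close> have to survive the passage from \<open>B\<close> to \<open>A\<close>; they
  are therefore required of all sets having the same trace as \<open>B\<close> on a fixed set \<open>E\<close> around \<open>B\<close>.
\<close>

definition stably_alternating :: "'b topology \<Rightarrow> nat \<Rightarrow> 'b set \<Rightarrow> 'b set \<Rightarrow> bool" where
  "stably_alternating Y n E B \<longleftrightarrow> (\<forall>A. A \<inter> E = B \<longrightarrow> alternation Y A n \<inter> B \<noteq> {})"

definition stably_missing_limit :: "'b topology \<Rightarrow> nat \<Rightarrow> 'b set \<Rightarrow> 'b set \<Rightarrow> bool" where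
  "stably_missing_limit Y n E B \<longleftrightarrow>
    (\<exists>y\<in>E - B. \<forall>A. A \<inter> E = B \<longrightarrow> y \<in> Y closure_of (alternation Y A n))"

lemma stably_alternatingD:
  "stably_alternating Y n E B \<Longrightarrow> A \<inter> E = B \<Longrightarrow> alternation Y A n \<inter> B \<noteq> {}"
  by (simp add: stably_alternating_def)

locale shrinking_pieces =
  fixes Y :: "'b topology" and y :: 'b and E B :: "nat \<Rightarrow> 'b set"
  assumes shrinks_to_limit: "shrinks_to Y E y"
    and disjoint: "disjoint_family E"
    and subset: "\<And>i. B i \<subseteq> E i"
    and limit_notin: "\<And>i. y \<notin> E i"
begin

lemma UN_Int_eq: "(\<Union>j. B j) \<inter> E i = B i"
proof
  show "(\<Union>j. B j) \<inter> E i \<subseteq> B i"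
  proof
    fix p assume p: "p \<in> (\<Union>j. B j) \<inter> E i"
    then obtain j where j: "p \<in> B j" by blast
    then have "j = i"
      using p subset[of j] disjoint_family_onD[OF disjoint, of j i] by blast
    with j show "p \<in> B i" by simp
  qed
qed (use subset in auto)

lemma stably_missing_limit_UN:
  assumes "\<And>i. stably_alternating Y n (E i) (B i)"
  shows "stably_missing_limit Y n (insert y (\<Union>i. E i)) (\<Union>i. B i)"
  unfolding stably_missing_limit_def
proof (intro bexI[of _ y] allI impI)
  show "y \<in> insert y (\<Union>i. E i) - (\<Union>i. B i)" using subset limit_notin by auto
  fix A assume A: "A \<inter> insert y (\<Union>i. E i) = (\<Union>i. B i)"
  have "\<exists>p\<in>alternation Y A n. p \<in> N" if N: "openin Y N" "y \<in> N" for N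
  proof -
    obtain i where i: "E i \<subseteq> N" by (rule shrinks_to_obtain_subset[OF shrinks_to_limit N])
    have "A \<inter> E i = (\<Union>i. B i) \<inter> E i" using A by blast
    then have "A \<inter> E i = B i" by (simp only: UN_Int_eq)
    then show ?thesis
      using stably_alternatingD[OF assms, of A i] i subset[of i] by blast
  qed
  then show "y \<in> Y closure_of (alternation Y A n)"
    using shrinks_to_imp_in_topspace[OF shrinks_to_limit] by (auto simp: in_closure_of)
qed

lemma stably_alternating_Suc_insert_UN:
  assumes "\<And>i. stably_missing_limit Y n (E i) (B i)"
  shows "stably_alternating Y (Suc n) (insert y (\<Union>i. E i)) (insert y (\<Union>i. B i))"
  unfolding stably_alternating_def
proof (intro allI impI)
  fix A assume A: "A \<inter> insert y (\<Union>i. E i) = insert y (\<Union>i. B i)"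
  have "\<exists>p\<in>Y closure_of (alternation Y A n) - A. p \<in> N" if N: "openin Y N" "y \<in> N" for N
  proof -
    obtain i where i: "E i \<subseteq> N" by (rule shrinks_to_obtain_subset[OF shrinks_to_limit N])
    have "A \<inter> E i = insert y (\<Union>i. B i) \<inter> E i" using A by blast
    then have trace: "A \<inter> E i = B i" using UN_Int_eq limit_notin by simp
    then obtain p where "p \<in> E i - B i" "p \<in> Y closure_of (alternation Y A n)"
      using assms[of i] by (auto simp: stably_missing_limit_def)
    then show ?thesis using trace i by blast
  qed
  then have "y \<in> Y closure_of (Y closure_of (alternation Y A n) - A)"
    using shrinks_to_imp_in_topspace[OF shrinks_to_limit] unfolding in_closure_of[of y] by blast
  then show "alternation Y A (Suc n) \<inter> insert y (\<Union>i. B i) \<noteq> {}"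
    using A by auto
qed

end

section \<open>Sets on which a map is piece-wise closed\<close>

definition piecewise_closed_on :: "'a topology \<Rightarrow> 'b topology \<Rightarrow> ('a \<Rightarrow> 'b) \<Rightarrow> 'a set \<Rightarrow> bool" where
  "piecewise_closed_on X Y f =
    countable union_of (\<lambda>Z. closedin X Z \<and> closed_map (subtopology X Z) Y f)"

lemma piecewise_closed_on_topspace:
  "piecewise_closed_on X Y f (topspace X) \<longleftrightarrow> piecewise_closed X Y f"
  unfolding piecewise_closed_on_def piecewise_closed_def
  by (subst countable_union_of_explicit) (auto simp: closed_map_on_empty all_conj_distrib)

lemma closed_map_imp_piecewise_closed_on:
  assumes "closedin X Z" "closed_map (subtopology X Z) Y f"
  shows "piecewise_closed_on X Y f Z"
  unfolding piecewise_closed_on_def using assms by (intro countable_union_of_inc) simp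

lemma piecewise_closed_on_Union:
  assumes "countable \<S>" "\<And>S. S \<in> \<S> \<Longrightarrow> piecewise_closed_on X Y f S"
  shows "piecewise_closed_on X Y f (\<Union>\<S>)"
  using assms unfolding piecewise_closed_on_def by (rule countable_union_of_Union)

lemma piecewise_closed_on_UN:
  assumes "countable I" "\<And>i. i \<in> I \<Longrightarrow> piecewise_closed_on X Y f (S i)"
  shows "piecewise_closed_on X Y f (\<Union>i\<in>I. S i)"
  using assms unfolding piecewise_closed_on_def by (rule countable_union_of_UN)

lemma piecewise_closed_on_Un:
  assumes "piecewise_closed_on X Y f S" "piecewise_closed_on X Y f T"
  shows "piecewise_closed_on X Y f (S \<union> T)"
  using assms unfolding piecewise_closed_on_def by (rule countable_union_of_Un)

lemma piecewise_closed_on_fsigma_in: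
  assumes "fsigma_in X S" "\<And>K. closedin X K \<Longrightarrow> K \<subseteq> S \<Longrightarrow> piecewise_closed_on X Y f K"
  shows "piecewise_closed_on X Y f S"
proof -
  obtain \<K> where "countable \<K>" "\<K> \<subseteq> Collect (closedin X)" "\<Union>\<K> = S"
    using assms(1) by (auto simp: fsigma_in_def union_of_def)
  then show ?thesis
    using piecewise_closed_on_Union[of \<K> X Y f] assms(2) by blast
qed

lemma piecewise_closed_on_subtopologyD:
  assumes "piecewise_closed_on (subtopology X T) Y f S" "closedin X T"
  shows "piecewise_closed_on X Y f S"
  using assms(1) unfolding piecewise_closed_on_def
proof (rule union_of_mono)
  fix Z
  assume Z: "closedin (subtopology X T) Z \<and> closed_map (subtopology (subtopology X T) Z) Y f"
  then have "closedin X Z" "Z \<subseteq> T"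
    using assms(2) closedin_closed_subtopology by blast+
  then show "closedin X Z \<and> closed_map (subtopology X Z) Y f"
    using Z by (simp add: subtopology_subtopology inf.absorb2)
qed

lemma piecewise_closed_on_closed_map_onto_image:
  assumes f: "continuous_map X Y f" "closed_map (subtopology X K) (subtopology Y (f ` K)) f"
    and K: "closedin X K" "fsigma_in Y (f ` K)"
  shows "piecewise_closed_on X Y f K"
proof -
  obtain \<C> where \<C>: "countable \<C>" "\<And>C. C \<in> \<C> \<Longrightarrow> closedin Y C" "\<Union>\<C> = f ` K"
    using K(2) by (auto simp: fsigma_in_def union_of_def)
  define Z where "Z C = K \<inter> {x \<in> topspace X. f x \<in> C}" for C
  have "piecewise_closed_on X Y f (Z C)" if C: "C \<in> \<C>" for C
  proof (rule closed_map_imp_piecewise_closed_on)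
    show "closedin X (Z C)"
      unfolding Z_def using K(1) closedin_continuous_map_preimage[OF f(1) \<C>(2)[OF C]] by blast
    have "closed_map (subtopology (subtopology X K) (Z C)) (subtopology (subtopology Y (f ` K)) C) f"
      by (rule closed_map_restriction[OF f(2)]) (auto simp: Z_def)
    moreover have "K \<inter> Z C = Z C" "f ` K \<inter> C = C"
      using \<C>(3) C by (auto simp: Z_def)
    ultimately have "closed_map (subtopology X (Z C)) (subtopology Y C) f"
      by (simp add: subtopology_subtopology)
    then show "closed_map (subtopology X (Z C)) Y f"
      using closed_map_compose[OF _ closed_map_inclusion[OF \<C>(2)[OF C]]] by fastforce
  qed
  then have "piecewise_closed_on X Y f (\<Union>C\<in>\<C>. Z C)"
    by (rule piecewise_closed_on_UN[OF \<C>(1)])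
  moreover have "(\<Union>C\<in>\<C>. Z C) = K \<inter> {x \<in> topspace X. f x \<in> \<Union>\<C>}"
    by (auto simp: Z_def)
  then have "(\<Union>C\<in>\<C>. Z C) = K"
    using closedin_subset[OF K(1)] unfolding \<C>(3) by blast
  ultimately show ?thesis by simp
qed

lemma piecewise_closed_on_countable_image:
  assumes "continuous_map X Y f" "t1_space Y" "fsigma_in X S" "countable (f ` S)"
  shows "piecewise_closed_on X Y f S"
proof (rule piecewise_closed_on_fsigma_in[OF assms(3)])
  fix K assume K: "closedin X K" "K \<subseteq> S"
  define Z where "Z c = K \<inter> {x \<in> topspace X. f x = c}" for c
  have "piecewise_closed_on X Y f (Z c)" if "c \<in> f ` K" for c
  proof (rule closed_map_imp_piecewise_closed_on)
    show "closedin X (Z c)"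
      unfolding Z_def by (rule closedin_Int[OF K(1) closedin_continuous_map_fibre[OF assms(1,2)]])
    have "c \<in> topspace Y"
      using that closedin_subset[OF K(1)] assms(1) by (auto simp: continuous_map_def)
    then have c: "closedin Y {c}" by (rule closedin_t1_singleton[OF assms(2)])
    have "closed_map (subtopology X (Z c)) Y (\<lambda>x. c)"
      using c by (simp add: closed_map_const)
    then show "closed_map (subtopology X (Z c)) Y f"
      by (rule closed_map_eq) (simp add: Z_def)
  qed
  moreover have "countable (f ` K)"
    using assms(4) K(2) by (meson countable_subset image_mono)
  ultimately have "piecewise_closed_on X Y f (\<Union>c\<in>f ` K. Z c)"
    by (intro piecewise_closed_on_UN)
  moreover have "(\<Union>c\<in>f ` K. Z c) = K"
    using closedin_subset[OF K(1)] by (auto simp: Z_def)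
  ultimately show "piecewise_closed_on X Y f K" by simp
qed

definition piecewise_closed_core :: "'a topology \<Rightarrow> 'b topology \<Rightarrow> ('a \<Rightarrow> 'b) \<Rightarrow> 'a set" where
  "piecewise_closed_core X Y f = \<Union>{U. openin X U \<and> piecewise_closed_on X Y f U}"

lemma openin_piecewise_closed_core: "openin X (piecewise_closed_core X Y f)"
  unfolding piecewise_closed_core_def by (rule openin_Union) simp

lemma subset_piecewise_closed_core:
  "openin X U \<Longrightarrow> piecewise_closed_on X Y f U \<Longrightarrow> U \<subseteq> piecewise_closed_core X Y f"
  unfolding piecewise_closed_core_def by blast

lemma piecewise_closed_on_core:
  assumes "second_countable X"
  shows "piecewise_closed_on X Y f (piecewise_closed_core X Y f)"
proof -
  let ?\<U> = "{U. openin X U \<and> piecewise_closed_on X Y f U}"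
  obtain \<V> where \<V>: "countable \<V>" "\<V> \<subseteq> ?\<U>" "\<Union>\<V> = \<Union>?\<U>"
    by (rule second_countable_countable_subfamily[OF assms, of ?\<U>]) auto
  have "piecewise_closed_on X Y f (\<Union>\<V>)"
    using \<V>(1,2) by (intro piecewise_closed_on_Union) auto
  then show ?thesis by (simp add: piecewise_closed_core_def \<V>(3))
qed

lemma piecewise_closed_on_outside_core_imp_empty:
  fixes X :: "'a topology" and Y :: "'b topology" and f :: "'a \<Rightarrow> 'b"
  defines "T \<equiv> topspace X - piecewise_closed_core X Y f"
  assumes "second_countable X"
    and W: "openin (subtopology X T) W" "piecewise_closed_on (subtopology X T) Y f W"
  shows "W = {}"
proof -
  let ?C = "piecewise_closed_core X Y f"
  have "closedin X T"
    unfolding T_def by (intro closedin_diff closedin_topspace openin_piecewise_closed_core)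
  then have "piecewise_closed_on X Y f (?C \<union> W)"
    by (intro piecewise_closed_on_Un piecewise_closed_on_core[OF assms(2)]
        piecewise_closed_on_subtopologyD[OF W(2)])
  moreover obtain V where V: "openin X V" "W = V \<inter> T"
    using W(1) by (auto simp: openin_subtopology)
  moreover have "?C \<union> W = ?C \<union> V"
    using V openin_subset[OF V(1)] by (auto simp: T_def)
  ultimately have "V \<subseteq> ?C"
    using subset_piecewise_closed_core[OF openin_Un[OF openin_piecewise_closed_core]] by fastforce
  then show ?thesis using V(2) by (auto simp: T_def)
qed

section \<open>Maps that are nowhere piece-wise closed\<close>

locale nowhere_piecewise_closed =
  fixes X :: "'a topology" and Y :: "'b topology" and f :: "'a \<Rightarrow> 'b"
  assumes metrizable_domain: "metrizable_space X" and metrizable_codomain: "metrizable_space Y"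
    and continuous: "continuous_map X Y f"
    and closed_constructible: "closed_constructible X Y f"
    and nowhere: "\<And>W. openin X W \<Longrightarrow> piecewise_closed_on X Y f W \<Longrightarrow> W = {}"
begin

lemma Hausdorff_domain: "Hausdorff_space X"
  using metrizable_domain by (rule metrizable_imp_Hausdorff_space)

lemma Hausdorff_codomain: "Hausdorff_space Y"
  using metrizable_codomain by (rule metrizable_imp_Hausdorff_space)

lemma map_in_topspace: "x \<in> topspace X \<Longrightarrow> f x \<in> topspace Y"
  using continuous by (auto simp: continuous_map_def)

lemma uncountable_image_openin:
  assumes "openin X W" "W \<noteq> {}"
  shows "uncountable (f ` W)"
  using assms nowhere piecewise_closed_on_countable_image[OF continuous]
    metrizable_imp_t1_space[OF metrizable_codomain] open_imp_fsigma_in[OF metrizable_domain] by blast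

lemma obtain_nonclosed_image:
  assumes "openin X V" "V \<noteq> {}"
  obtains H y where "closedin X H" "H \<subseteq> V" "y \<in> f ` V" "y \<in> Y closure_of (f ` H)" "y \<notin> f ` H"
proof -
  obtain K where K: "closedin X K" "K \<subseteq> V" "\<not> piecewise_closed_on X Y f K"
    using piecewise_closed_on_fsigma_in[OF open_imp_fsigma_in[OF metrizable_domain assms(1)]]
      nowhere[OF assms(1)] assms(2) by blast
  have "fsigma_in Y (f ` K)"
    using closed_constructible K(1) constructible_in_imp_fsigma_in[OF metrizable_codomain]
    by (simp add: closed_constructible_def)
  then have "\<not> closed_map (subtopology X K) (subtopology Y (f ` K)) f"
    using piecewise_closed_on_closed_map_onto_image[OF continuous] K by blast
  then obtain H where H: "closedin X H" "H \<subseteq> K" "\<not> closedin (subtopology Y (f ` K)) (f ` H)"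
    using K(1) by (auto simp: closed_map_def closedin_closed_subtopology)
  have "f ` H \<subseteq> topspace Y"
    using closedin_subset[OF H(1)] map_in_topspace by blast
  then have "\<not> f ` K \<inter> Y closure_of (f ` H) \<subseteq> f ` H"
    using H(2,3) by (auto simp: closure_of_subset_eq[symmetric] closure_of_subtopology
        Int_absorb1 image_mono)
  then show ?thesis using that H K(2) by blast
qed

lemma obtain_locally_finite_shrinking_images:
  assumes V: "openin X V" "V \<noteq> {}"
  obtains y and W :: "nat \<Rightarrow> 'a set" where "y \<in> f ` V"
    "\<And>i. openin X (W i)" "\<And>i. W i \<noteq> {}" "\<And>i. W i \<subseteq> V"
    "shrinks_to Y (\<lambda>i. f ` W i) y" "locally_finite_family X W"
proof -
  obtain H y where H: "closedin X H" "H \<subseteq> V" and y: "y \<in> f ` V" "y \<in> Y closure_of (f ` H)" "y \<notin> f ` H"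
    by (rule obtain_nonclosed_image[OF V])
  obtain W :: "nat \<Rightarrow> 'a set" where "\<And>i. openin X (W i)" "\<And>i. W i \<noteq> {}" "\<And>i. W i \<subseteq> V"
    "shrinks_to Y (\<lambda>i. f ` W i) y" "locally_finite_family X W"
    by (rule closure_of_image_obtain_locally_finite_family[OF
          metrizable_imp_normal_space[OF metrizable_domain] Hausdorff_codomain
          metrizable_imp_first_countable[OF metrizable_codomain] continuous V(1) H y(2,3)]) (rule that)
  with y(1) show ?thesis by (rule that)
qed

definition isolated_piece :: "'a set \<Rightarrow> 'a set \<Rightarrow> 'b set \<Rightarrow> bool" where
  "isolated_piece U F E \<longleftrightarrow>
    closedin X F \<and> F \<subseteq> U \<and> closedin Y E \<and> countable E \<and> f ` F \<subseteq> E \<and> E \<subseteq> f ` U"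

definition abundant :: "('b set \<Rightarrow> 'b set \<Rightarrow> bool) \<Rightarrow> bool" where
  "abundant Q \<longleftrightarrow>
    (\<forall>U. openin X U \<longrightarrow> U \<noteq> {} \<longrightarrow> (\<exists>F E. isolated_piece U F E \<and> Q E (f ` F)))"

lemma abundantI:
  assumes "\<And>U. openin X U \<Longrightarrow> U \<noteq> {} \<Longrightarrow> \<exists>F E. isolated_piece U F E \<and> Q E (f ` F)"
  shows "abundant Q"
  using assms by (simp add: abundant_def)

lemma isolated_piece_insert_UN:
  fixes W :: "nat \<Rightarrow> 'a set"
  assumes piece: "\<And>i. isolated_piece (W i) (F i) (E i)" and W: "\<And>i. W i \<subseteq> U"
    and y: "shrinks_to Y E y" "y \<in> f ` U"
    and G: "closedin X G" "G \<subseteq> U" "f ` G \<subseteq> insert y (\<Union>i. E i)"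
  shows "isolated_piece U G (insert y (\<Union>i. E i))"
proof -
  have "closedin Y (insert y (\<Union>i. E i))"
    using piece by (intro closedin_insert_UN_shrinks_to[OF Hausdorff_codomain _ y(1)])
      (simp add: isolated_piece_def)
  moreover have "countable (insert y (\<Union>i. E i))"
    using piece by (simp add: isolated_piece_def)
  moreover have "E i \<subseteq> f ` W i" for i
    using piece[of i] by (simp add: isolated_piece_def)
  then have "insert y (\<Union>i. E i) \<subseteq> f ` U"
    by (intro insert_subsetI[OF y(2)] UN_least order_trans[OF _ image_mono[OF W]])
  ultimately show ?thesis
    using G by (simp add: isolated_piece_def)
qed

lemma abundant_avoiding_countable:
  assumes "abundant Q" and U: "openin X U" "U \<noteq> {}" and C: "closedin Y C" "countable C"
  obtains F E where "isolated_piece U F E" "Q E (f ` F)" "disjnt E C"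
proof -
  let ?V = "U - {x \<in> topspace X. f x \<in> C}"
  have "openin X ?V"
    using U(1) closedin_continuous_map_preimage[OF continuous C(1)] by blast
  moreover have "\<not> f ` U \<subseteq> C"
    using uncountable_image_openin[OF U] C(2) countable_subset by blast
  then have "?V \<noteq> {}" by blast
  ultimately obtain F E where FE: "isolated_piece ?V F E" "Q E (f ` F)"
    using assms(1) unfolding abundant_def by blast
  have "isolated_piece U F E" "disjnt E C"
    using FE(1) openin_subset[OF U(1)] by (auto simp: isolated_piece_def disjnt_iff)
  with FE(2) that show ?thesis by blast
qed

lemma obtain_disjoint_isolated_pieces:
  fixes W :: "nat \<Rightarrow> 'a set"
  assumes W: "\<And>i. openin X (W i)" "\<And>i. W i \<noteq> {}"
    and Q: "\<And>i. abundant (Q i)"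
    and y: "y \<in> topspace Y"
  obtains F E where "\<And>i. isolated_piece (W i) (F i) (E i)" "\<And>i. Q i (E i) (f ` F i)"
    "disjoint_family E" "\<And>i. y \<notin> E i"
proof -
  define P where "P g i p \<longleftrightarrow> isolated_piece (W i) (fst p) (snd p) \<and> Q i (snd p) (f ` fst p) \<and>
      disjnt (snd p) (insert y (\<Union>j<i. snd (g j)))" for g :: "nat \<Rightarrow> 'a set \<times> 'b set" and i p
  have "\<exists>g. \<forall>i. P g i (g i)"
  proof (rule dependent_wellorder_choice)
    fix i and g :: "nat \<Rightarrow> 'a set \<times> 'b set"
    assume "\<And>j. j < i \<Longrightarrow> P g j (g j)"
    then have E: "closedin Y (snd (g j))" "countable (snd (g j))" if "j < i" for j
      using that by (simp_all add: P_def isolated_piece_def)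
    have "closedin Y ({y} \<union> (\<Union>j<i. snd (g j)))"
      using E(1) y Hausdorff_codomain
      by (intro closedin_Un closedin_Union) (auto simp: closedin_Hausdorff_singleton)
    moreover have "countable (insert y (\<Union>j<i. snd (g j)))" using E(2) by auto
    ultimately obtain F E where "isolated_piece (W i) F E" "Q i E (f ` F)"
        "disjnt E (insert y (\<Union>j<i. snd (g j)))"
      using abundant_avoiding_countable[OF Q W] by (metis insert_is_Un)
    then show "\<exists>p. P g i p" by (intro exI[of _ "(F, E)"]) (simp add: P_def)
  qed (simp add: P_def)
  then obtain g where g: "\<And>i. P g i (g i)" by blast
  have "snd (g i) \<inter> snd (g j) = {}" if "j < i" for i j
    using g[of i] that by (auto simp: P_def disjnt_iff)
  then have "disjoint_family (\<lambda>i. snd (g i))"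
    unfolding disjoint_family_on_def by (metis Int_commute linorder_neqE_nat)
  then show ?thesis
    using g by (intro that[of "\<lambda>i. fst (g i)" "\<lambda>i. snd (g i)"]) (simp_all add: P_def)
qed

lemma obtain_shrinking_pieces:
  fixes W :: "nat \<Rightarrow> 'a set"
  assumes W: "\<And>i. openin X (W i)" "\<And>i. W i \<noteq> {}"
    and Q: "\<And>i. abundant (Q i)"
    and shrinks: "shrinks_to Y (\<lambda>i. f ` W i) y"
  obtains F E where "\<And>i. isolated_piece (W i) (F i) (E i)" "\<And>i. Q i (E i) (f ` F i)"
    "shrinking_pieces Y y E (\<lambda>i. f ` F i)"
proof -
  obtain F E where piece: "\<And>i. isolated_piece (W i) (F i) (E i)" and QE: "\<And>i. Q i (E i) (f ` F i)"
    and disjoint: "disjoint_family E" "\<And>i. y \<notin> E i"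
    by (rule obtain_disjoint_isolated_pieces[OF W Q shrinks_to_imp_in_topspace[OF shrinks]])
      (rule that)
  have "shrinks_to Y E y"
    using piece by (intro shrinks_to_mono[OF shrinks]) (simp add: isolated_piece_def)
  then have "shrinking_pieces Y y E (\<lambda>i. f ` F i)"
    using piece disjoint by unfold_locales (simp_all add: isolated_piece_def)
  with piece QE show ?thesis by (rule that)
qed

lemma abundant_stably_alternating_0: "abundant (stably_alternating Y 0)"
proof (rule abundantI)
  fix U assume U: "openin X U" "U \<noteq> {}"
  then obtain x where x: "x \<in> U" "x \<in> topspace X" using openin_subset by blast
  then have "isolated_piece U {x} {f x}"
    using map_in_topspace Hausdorff_domain Hausdorff_codomain
    by (simp add: isolated_piece_def closedin_Hausdorff_singleton)
  moreover have "stably_alternating Y 0 {f x} (f ` {x})"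
    by (auto simp: stably_alternating_def)
  ultimately show "\<exists>F E. isolated_piece U F E \<and> stably_alternating Y 0 E (f ` F)" by blast
qed

lemma abundant_stably_missing_limit:
  assumes "abundant (stably_alternating Y n)"
  shows "abundant (stably_missing_limit Y n)"
proof (rule abundantI)
  fix V assume V: "openin X V" "V \<noteq> {}"
  obtain y and W :: "nat \<Rightarrow> 'a set" where y: "y \<in> f ` V"
    and W: "\<And>i. openin X (W i)" "\<And>i. W i \<noteq> {}" "\<And>i. W i \<subseteq> V"
    and shrinks: "shrinks_to Y (\<lambda>i. f ` W i) y" and locally_finite: "locally_finite_family X W"
    by (rule obtain_locally_finite_shrinking_images[OF V]) (rule that)
  obtain F E where piece: "\<And>i. isolated_piece (W i) (F i) (E i)"
    and alternating: "\<And>i. stably_alternating Y n (E i) (f ` F i)"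
    and pieces: "shrinking_pieces Y y E (\<lambda>i. f ` F i)"
    by (rule obtain_shrinking_pieces[OF W(1,2) assms shrinks]) (rule that)
  interpret shrinking_pieces Y y E "\<lambda>i. f ` F i" by (rule pieces)
  have F: "closedin X (F i)" "F i \<subseteq> W i" for i
    using piece[of i] by (simp_all add: isolated_piece_def)
  have "isolated_piece V (\<Union>i. F i) (insert y (\<Union>i. E i))"
  proof (rule isolated_piece_insert_UN[OF piece W(3) shrinks_to_limit y])
    show "closedin X (\<Union>i. F i)"
      by (rule closedin_UN_locally_finite_family[OF locally_finite F])
    show "(\<Union>i. F i) \<subseteq> V"
      using order_trans[OF F(2) W(3)] by (rule UN_least)
    show "f ` (\<Union>i. F i) \<subseteq> insert y (\<Union>i. E i)"
      unfolding image_UN using UN_mono[OF order_refl subset] by (rule subset_insertI2)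
  qed
  moreover have "stably_missing_limit Y n (insert y (\<Union>i. E i)) (f ` (\<Union>i. F i))"
    unfolding image_UN by (rule stably_missing_limit_UN[OF alternating])
  ultimately show "\<exists>F E. isolated_piece V F E \<and> stably_missing_limit Y n E (f ` F)" by blast
qed

lemma abundant_stably_alternating_Suc:
  assumes "abundant (stably_missing_limit Y n)"
  shows "abundant (stably_alternating Y (Suc n))"
proof (rule abundantI)
  fix U assume U: "openin X U" "U \<noteq> {}"
  then obtain x where x: "x \<in> U" "x \<in> topspace X" using openin_subset by blast
  obtain B :: "nat \<Rightarrow> 'a set" where B: "\<And>n. openin X (B n)" "\<And>n. x \<in> B n" "shrinks_to X B x"
    using first_countable_shrinking_base[OF metrizable_imp_first_countable[OF metrizable_domain] x(2)]
    by blast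
  define W where "W i = U \<inter> B i" for i
  have W: "openin X (W i)" "W i \<noteq> {}" "W i \<subseteq> U" for i
    using U B x by (auto simp: W_def)
  have shrinks_W: "shrinks_to X W x"
    by (rule shrinks_to_mono[OF B(3)]) (simp add: W_def)
  obtain F E where piece: "\<And>i. isolated_piece (W i) (F i) (E i)"
    and missing: "\<And>i. stably_missing_limit Y n (E i) (f ` F i)"
    and pieces: "shrinking_pieces Y (f x) E (\<lambda>i. f ` F i)"
    by (rule obtain_shrinking_pieces[OF W(1,2) assms
          shrinks_to_continuous_map_image[OF shrinks_W continuous]]) (rule that)
  interpret shrinking_pieces Y "f x" E "\<lambda>i. f ` F i" by (rule pieces)
  have F: "closedin X (F i)" "F i \<subseteq> W i" for i
    using piece[of i] by (simp_all add: isolated_piece_def)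
  have "isolated_piece U (insert x (\<Union>i. F i)) (insert (f x) (\<Union>i. E i))"
  proof (rule isolated_piece_insert_UN[OF piece W(3) shrinks_to_limit imageI[OF x(1)]])
    show "closedin X (insert x (\<Union>i. F i))"
      by (rule closedin_insert_UN_shrinks_to[OF Hausdorff_domain F(1) shrinks_to_mono[OF shrinks_W F(2)]])
    show "insert x (\<Union>i. F i) \<subseteq> U"
      using x(1) UN_least[OF order_trans[OF F(2) W(3)]] by (rule insert_subsetI)
    show "f ` insert x (\<Union>i. F i) \<subseteq> insert (f x) (\<Union>i. E i)"
      unfolding image_insert image_UN by (intro insert_mono UN_mono order_refl subset)
  qed
  moreover have "stably_alternating Y (Suc n) (insert (f x) (\<Union>i. E i)) (f ` insert x (\<Union>i. F i))"
    unfolding image_insert image_UN by (rule stably_alternating_Suc_insert_UN[OF missing])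
  ultimately show "\<exists>F E. isolated_piece U F E \<and> stably_alternating Y (Suc n) E (f ` F)" by blast
qed

lemma abundant_stably_alternating: "abundant (stably_alternating Y n)"
proof (induction n)
  case 0
  show ?case by (rule abundant_stably_alternating_0)
next
  case (Suc n)
  then show ?case by (intro abundant_stably_alternating_Suc abundant_stably_missing_limit)
qed

lemma topspace_domain_empty: "topspace X = {}"
proof (rule ccontr)
  assume "topspace X \<noteq> {}"
  then obtain y and W :: "nat \<Rightarrow> 'a set" where W: "\<And>i. openin X (W i)" "\<And>i. W i \<noteq> {}"
    and shrinks: "shrinks_to Y (\<lambda>i. f ` W i) y" and locally_finite: "locally_finite_family X W"
    using obtain_locally_finite_shrinking_images[OF openin_topspace] by metis
  obtain F E where piece: "\<And>i. isolated_piece (W i) (F i) (E i)"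
    and alternating: "\<And>i. stably_alternating Y i (E i) (f ` F i)"
    and pieces: "shrinking_pieces Y y E (\<lambda>i. f ` F i)"
    by (rule obtain_shrinking_pieces[OF W abundant_stably_alternating shrinks]) (rule that)
  let ?A = "\<Union>i. f ` F i"
  have "closedin X (\<Union>i. F i)"
    using piece by (intro closedin_UN_locally_finite_family[OF locally_finite])
      (simp_all add: isolated_piece_def)
  then have "constructible_in Y ?A"
    using closed_constructible unfolding closed_constructible_def by (metis image_UN)
  then obtain n where "alternation Y ?A n = {}"
    by (rule constructible_in_imp_alternation_empty)
  moreover have "alternation Y ?A n \<inter> f ` F n \<noteq> {}"
    by (rule stably_alternatingD[OF alternating shrinking_pieces.UN_Int_eq[OF pieces]])
  ultimately show False by blast
qed

end

theorem theorem1: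
  fixes X :: "'a topology" and Y :: "'b topology" and f :: "'a \<Rightarrow> 'b"
  assumes "metrizable_space X" and "separable_space X"
    and "metrizable_space Y" and "separable_space Y"
    and "continuous_map X Y f"
    and "f ` topspace X = topspace Y"
    and "closed_constructible X Y f"
  shows "piecewise_closed X Y f"
proof -
  have second_countable: "second_countable X"
    using assms(1,2) by (rule metrizable_separable_imp_second_countable)
  define T where "T = topspace X - piecewise_closed_core X Y f"
  have T: "closedin X T"
    unfolding T_def by (intro closedin_diff closedin_topspace openin_piecewise_closed_core)
  interpret nowhere_piecewise_closed "subtopology X T" Y f
  proof
    show "closed_constructible (subtopology X T) Y f"
      using assms(7) T by (simp add: closed_constructible_def closedin_closed_subtopology)
    show "W = {}" if "openin (subtopology X T) W" "piecewise_closed_on (subtopology X T) Y f W" for W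
      using piecewise_closed_on_outside_core_imp_empty[OF second_countable] that unfolding T_def .
  qed (use assms in \<open>auto simp: metrizable_space_subtopology continuous_map_from_subtopology\<close>)
  have "T = {}"
    using topspace_domain_empty closedin_subset[OF T] by (simp add: inf.absorb2)
  then have "piecewise_closed_core X Y f = topspace X"
    using openin_subset[OF openin_piecewise_closed_core[of X Y f]] unfolding T_def by blast
  then show ?thesis
    using piecewise_closed_on_core[OF second_countable] piecewise_closed_on_topspace by metis
qed

end
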